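(* Let $\mathcal{K}(\mathbb{E}_2)\cong\mathbb{R}^6$ be the space of Killing $2$-tensors of the Euclidean plane with coordinates $(A,B,C,\alpha,\beta,\gamma)$, let $\Delta_E$ be the distribution spanned by $V_1,\dots,V_6$, let $G_E$ be the web-type preserving group, and let $S_1,S_2$ be the subsets defined in the context. On $S_2\setminus S_1$ the rank of the distribution $\Delta_E$ is $4$, and $S_2\setminus S_1$ is an orbit of the action of $G_E$ on $\mathcal{K}(\mathbb{E}_2)$.
   Context: In the Euclidean plane $\mathbb{E}_2$ with Cartesian coordinates $(x,y)$ and standard metric $\mathbf{g}$, the general Killing $2$-tensor has contravariant components $K^{11}=A+2\alpha y+\gamma y^2$, $K^{12}=K^{21}=C-\alpha x-\beta y-\gamma xy$, $K^{22}=B+2\beta x+\gamma x^2$, with $A,B,C,\alpha,\beta,\gamma\in\mathbb{R}$. So the vector space $\mathcal{K}(\mathbb{E}_2)$ of Killing $2$-tensors is identified with $\mathbb{R}^6$ with coordinates $(A,B,C,\alpha,\beta,\gamma)$. With respect to $(\partial_A,\partial_B,\partial_C,\partial_\alpha,\partial_\beta,\partial_\gamma)$ define the following vector fields on $\mathcal{K}(\mathbb{E}_2)$, generating the transformations which preserve the type of the web: $V_1=(0,-2\beta,\alpha,0,-\gamma,0)$ and $V_2=(-2\alpha,0,\beta,-\gamma,0,0)$ (translations); $V_3=(-2C,2C,A-B,\beta,-\alpha,0)$ (rotation); $V_4=(2A,2B,2C,\alpha,\beta,0)$ (dilatation of the plane); $V_5=(1,1,0,0,0,0)$ (addition of a multiple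 of the metric, $\mathbf{K}\mapsto\mathbf{K}+\tau\mathbf{g}$); $V_6=(A,B,C,\alpha,\beta,\gamma)$ (scalar multiplication, $\mathbf{K}\mapsto\lambda\mathbf{K}$). $\Delta_E$ is the distribution spanned by $V_1,\dots,V_6$; its rank at a point is the dimension of the span of the values of $V_1,\dots,V_6$ at that point. $G_E$ is the group of transformations of $\mathcal{K}(\mathbb{E}_2)$ generated by the flows of $V_1,\dots,V_6$ together with the change of sign $\mathbf{K}\mapsto-\mathbf{K}$. $S_1=\{\gamma=0\}$; $S_2=\{\alpha^2-\beta^2=\gamma(A-B),\ \alpha\beta=-\gamma C\}$. *)

theory Defs
  imports "HOL-Analysis.Analysis" "HOL-Algebra.Group_Action" "HOL-Algebra.Elementary_Groups"
begin

(* Coordinates (A, B, C, \<alpha>, \<beta>, \<gamma>) on the six-dimensional space of Killing 2-tensors of the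
   Euclidean plane. *)
type_synonym killing = "real \<times> real \<times> real \<times> real \<times> real \<times> real"

(* Contravariant Cartesian components at the point (x, y). Through killing_tensor, a point of
   type killing is identified with the Killing tensor field that it parametrizes. *)
definition killing_tensor :: "killing \<Rightarrow> real \<times> real \<Rightarrow> real ^ 2 ^ 2" where
  "killing_tensor = (\<lambda>(A, B, C, \<alpha>, \<beta>, \<gamma>) (x, y).
     vector [vector [A + 2 * \<alpha> * y + \<gamma> * y\<^sup>2, C - \<alpha> * x - \<beta> * y - \<gamma> * x * y],
             vector [C - \<alpha> * x - \<beta> * y - \<gamma> * x * y, B + 2 * \<beta> * x + \<gamma> * x\<^sup>2]])"

lemma killing_tensor_add:
  "killing_tensor (K + L) p = killing_tensor K p + killing_tensor L p"
  by (cases K; cases L; cases p)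
     (simp add: killing_tensor_def vec_eq_iff forall_2 algebra_simps)

lemma killing_tensor_scaleR:
  "killing_tensor (c *\<^sub>R K) p = c *\<^sub>R killing_tensor K p"
  by (cases K; cases p)
     (simp add: killing_tensor_def vec_eq_iff forall_2 algebra_simps)

lemma killing_tensor_metric:
  "killing_tensor (1, 1, 0, 0, 0, 0) p = mat 1"
  by (cases p) (simp add: killing_tensor_def vec_eq_iff forall_2 mat_def)

lemma inj_killing_tensor: "inj killing_tensor"
proof (rule injI)
  fix K L :: killing
  assume eq: "killing_tensor K = killing_tensor L"
  obtain A B C a b c where K: "K = (A, B, C, a, b, c)" by (cases K)
  obtain A' B' C' a' b' c' where L: "L = (A', B', C', a', b', c')" by (cases L)
  have *: "killing_tensor K (x, y) = killing_tensor L (x, y)" for x y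
    by (simp add: eq)
  show "K = L"
    using *[of 0 0] *[of 0 1] *[of 1 0] *[of 0 "-1"] *[of "-1" 0]
    by (simp add: K L killing_tensor_def vec_eq_iff forall_2)
qed

definition V1 :: "killing \<Rightarrow> killing" where
  "V1 = (\<lambda>(A, B, C, \<alpha>, \<beta>, \<gamma>). (0, - 2 * \<beta>, \<alpha>, 0, - \<gamma>, 0))"

definition V2 :: "killing \<Rightarrow> killing" where
  "V2 = (\<lambda>(A, B, C, \<alpha>, \<beta>, \<gamma>). (- 2 * \<alpha>, 0, \<beta>, - \<gamma>, 0, 0))"

definition V3 :: "killing \<Rightarrow> killing" where
  "V3 = (\<lambda>(A, B, C, \<alpha>, \<beta>, \<gamma>). (- 2 * C, 2 * C, A - B, \<beta>, - \<alpha>, 0))"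

definition V4 :: "killing \<Rightarrow> killing" where
  "V4 = (\<lambda>(A, B, C, \<alpha>, \<beta>, \<gamma>). (2 * A, 2 * B, 2 * C, \<alpha>, \<beta>, 0))"

definition V5 :: "killing \<Rightarrow> killing" where
  "V5 = (\<lambda>(A, B, C, \<alpha>, \<beta>, \<gamma>). (1, 1, 0, 0, 0, 0))"

definition V6 :: "killing \<Rightarrow> killing" where
  "V6 = (\<lambda>(A, B, C, \<alpha>, \<beta>, \<gamma>). (A, B, C, \<alpha>, \<beta>, \<gamma>))"

definition generators_E :: "(killing \<Rightarrow> killing) set" where
  "generators_E = {V1, V2, V3, V4, V5, V6}"

definition Delta_E :: "killing \<Rightarrow> killing set" where
  "Delta_E K = span {V K | V. V \<in> generators_E}"

definition rank_Delta_E :: "killing \<Rightarrow> nat" where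
  "rank_Delta_E K = dim (Delta_E K)"

(* Global flow. All the generators are complete (lemma generators_E_complete below), so no
   partially defined local flows have to be considered. *)
definition is_flow :: "('a::real_normed_vector \<Rightarrow> 'a) \<Rightarrow> (real \<Rightarrow> 'a \<Rightarrow> 'a) \<Rightarrow> bool" where
  "is_flow V \<phi> \<longleftrightarrow>
     (\<forall>p. \<phi> 0 p = p) \<and>
     (\<forall>p t. ((\<lambda>s. \<phi> s p) has_vector_derivative V (\<phi> t p)) (at t))"

lemma generators_E_complete:
  assumes "V \<in> generators_E"
  shows "\<exists>\<phi>. is_flow V \<phi>"
proof -
  have 1: "is_flow V1 (\<lambda>t (A, B, C, a, b, c).
      (A, B - 2 * b * t + c * t\<^sup>2, C + a * t, a, b - c * t, c))"
    unfolding is_flow_def V1_def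
    by (auto intro!: has_vector_derivative_Pair derivative_eq_intros
        simp: zero_prod_def has_real_derivative_iff_has_vector_derivative [symmetric] algebra_simps)
  have 2: "is_flow V2 (\<lambda>t (A, B, C, a, b, c).
      (A - 2 * a * t + c * t\<^sup>2, B, C + b * t, a - c * t, b, c))"
    unfolding is_flow_def V2_def
    by (auto intro!: has_vector_derivative_Pair derivative_eq_intros
        simp: zero_prod_def has_real_derivative_iff_has_vector_derivative [symmetric] algebra_simps)
  have 3: "is_flow V3 (\<lambda>t (A, B, C, a, b, c).
      ((A + B) / 2 + ((A - B) / 2 * cos (2 * t) - C * sin (2 * t)),
       (A + B) / 2 - ((A - B) / 2 * cos (2 * t) - C * sin (2 * t)),
       C * cos (2 * t) + (A - B) / 2 * sin (2 * t),
       a * cos t + b * sin t, b * cos t - a * sin t, c))"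
    unfolding is_flow_def V3_def
    by (auto intro!: has_vector_derivative_Pair derivative_eq_intros
        simp: zero_prod_def has_real_derivative_iff_has_vector_derivative [symmetric] field_simps)
  have 4: "is_flow V4 (\<lambda>t (A, B, C, a, b, c).
      (A * exp (2 * t), B * exp (2 * t), C * exp (2 * t), a * exp t, b * exp t, c))"
    unfolding is_flow_def V4_def
    by (auto intro!: has_vector_derivative_Pair derivative_eq_intros
        simp: zero_prod_def has_real_derivative_iff_has_vector_derivative [symmetric])
  have 5: "is_flow V5 (\<lambda>t (A, B, C, a, b, c). (A + t, B + t, C, a, b, c))"
    unfolding is_flow_def V5_def
    by (auto intro!: has_vector_derivative_Pair derivative_eq_intros
        simp: zero_prod_def has_real_derivative_iff_has_vector_derivative [symmetric])
  have 6: "is_flow V6 (\<lambda>t (A, B, C, a, b, c).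
      (A * exp t, B * exp t, C * exp t, a * exp t, b * exp t, c * exp t))"
    unfolding is_flow_def V6_def
    by (auto intro!: has_vector_derivative_Pair derivative_eq_intros
        simp: zero_prod_def has_real_derivative_iff_has_vector_derivative [symmetric])
  show ?thesis
    using assms 1 2 3 4 5 6 unfolding generators_E_def by blast
qed

definition flow_maps_E :: "(killing \<Rightarrow> killing) set" where
  "flow_maps_E = {\<phi> t | V \<phi> t. V \<in> generators_E \<and> is_flow V \<phi>}"

(* subgroup_generated only retains those generators that are bijections; time-t maps of flows of
   these affine vector fields always are, by uniqueness of solutions. *)
definition G_E :: "(killing \<Rightarrow> killing) monoid" where
  "G_E = subgroup_generated (BijGroup UNIV) (flow_maps_E \<union> {uminus})"

lemma group_action_G_E: "group_action G_E UNIV (\<lambda>g. g)"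
proof -
  interpret group "BijGroup (UNIV :: killing set)" by (rule group_BijGroup)
  show ?thesis
    unfolding group_action_def G_E_def group_hom_def group_hom_axioms_def
    using carrier_subgroup_generated_subset
    by (auto simp: hom_def intro: group_subgroup_generated)
qed

definition S1 :: "killing set" where
  "S1 = {(A, B, C, \<alpha>, \<beta>, \<gamma>). \<gamma> = 0}"

definition S2 :: "killing set" where
  "S2 = {(A, B, C, \<alpha>, \<beta>, \<gamma>). \<alpha>\<^sup>2 - \<beta>\<^sup>2 = \<gamma> * (A - B) \<and> \<alpha> * \<beta> = - \<gamma> * C}"

end

theory Submission
  imports Defs
begin

text \<open>
  The complex number \<open>(\<alpha>\<^sup>2 - \<beta>\<^sup>2 - \<gamma> (A - B)) + 2 \<i> (\<alpha> \<beta> + \<gamma> C)\<close> vanishes exactly on \<open>S2\<close>, and the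
  generators only rescale it (\<open>V4\<close>, \<open>V6\<close>), rotate it (\<open>V3\<close>) or leave it alone (the others).  Hence its
  squared modulus satisfies a scalar linear equation \<open>u' = k u\<close> along every flow, and so does
  \<open>\<gamma>\<close>.  A solution of such an equation vanishes always or never, so every flow map, and with it
  every element of the group, maps both \<open>S2 - S1\<close> and its complement into themselves.  The
  argument applies to any flow of a generator, whether or not an explicit formula for it is known.

  Conversely, a tensor in \<open>S2 - S1\<close> is determined by \<open>A\<close>, \<open>\<alpha>\<close>, \<open>\<beta>\<close> and \<open>\<gamma> \<noteq> 0\<close>, and these four
  parameters can be produced from the tensor \<open>(0, 0, 0, 0, 0, 1)\<close> one after the other: \<open>\<gamma>\<close> by a
  scaling and possibly a change of sign, \<open>\<beta>\<close> and \<open>\<alpha>\<close> by the two translations, \<open>A\<close> by adding a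
  multiple of the metric.  Geometrically, the tensors of \<open>S2 - S1\<close> are those of the webs of
  concentric circles and their radii, and the translations move the common centre to the origin.

  The rank is computed with the same four generators: \<open>V1\<close>, \<open>V2\<close>, \<open>V5\<close>, \<open>V6\<close> are independent
  wherever \<open>\<gamma> \<noteq> 0\<close>, and the equations of \<open>S2\<close> are what puts the rotation and the dilatation
  into their span, since both agree up to a multiple of the metric with translations
  that depend on the centre.
\<close>

section \<open>Rank of the distribution\<close>

lemma Delta_E_eq:
  "Delta_E K = span {V1 K, V2 K, V3 K, V4 K, V5 K, V6 K}"
proof -
  have "{V K |V. V \<in> generators_E} = {V1 K, V2 K, V3 K, V4 K, V5 K, V6 K}"
    unfolding generators_E_def by blast
  then show ?thesis by (simp add: Delta_E_def)
qed

lemma V3_V4_in_span: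
  assumes "K \<in> S2 - S1"
  shows "V3 K \<in> span {V1 K, V2 K, V5 K, V6 K}" "V4 K \<in> span {V1 K, V2 K, V5 K, V6 K}"
proof -
  obtain A B C a b c where K: "K = (A, B, C, a, b, c)" by (cases K)
  have c: "c \<noteq> 0" and ab: "a\<^sup>2 - b\<^sup>2 = c * (A - B)" "a * b = - c * C"
    using assms by (auto simp: K S1_def S2_def)
  have B: "B = A - (a\<^sup>2 - b\<^sup>2) / c" and C: "C = - (a * b) / c"
    using c ab by (auto simp: field_simps)
  let ?T = "span {V1 K, V2 K, V5 K, V6 K}"
  have gen: "V1 K \<in> ?T" "V2 K \<in> ?T" "V5 K \<in> ?T"
    by (auto intro: span_base)
  \<comment> \<open>The coefficients of the translations are read off from the last three components; they are
    the coordinates \<open>(- \<beta> / \<gamma>, - \<alpha> / \<gamma>)\<close> of the centre of the web, turned by a right angle for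
    the rotation.\<close>
  have "V3 K = (a / c) *\<^sub>R V1 K + (- b / c) *\<^sub>R V2 K"
    using c by (simp add: K V1_def V2_def V3_def B C field_simps power2_eq_square)
  with gen show "V3 K \<in> ?T"
    by (simp only: span_add span_scale)
  have "V4 K = (- b / c) *\<^sub>R V1 K + (- a / c) *\<^sub>R V2 K + (2 * A - 2 * a\<^sup>2 / c) *\<^sub>R V5 K"
    using c by (simp add: K V1_def V2_def V4_def V5_def B C field_simps power2_eq_square)
  with gen show "V4 K \<in> ?T"
    by (simp only: span_add span_scale)
qed

lemma independent_V1_V2_V5_V6:
  assumes "K \<notin> S1"
  shows "independent {V1 K, V2 K, V5 K, V6 K}" "card {V1 K, V2 K, V5 K, V6 K} = 4"
proof -
  obtain A B C a b c where K: "K = (A, B, C, a, b, c)" by (cases K)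
  have c: "c \<noteq> 0" using assms by (simp add: K S1_def)
  have distinct: "distinct [V1 K, V2 K, V5 K, V6 K]"
    using c by (simp add: K V1_def V2_def V5_def V6_def)
  then show "card {V1 K, V2 K, V5 K, V6 K} = 4" by simp
  show "independent {V1 K, V2 K, V5 K, V6 K}"
  proof (rule independent_if_scalars_zero)
    fix f x
    assume "(\<Sum>x\<in>{V1 K, V2 K, V5 K, V6 K}. f x *\<^sub>R x) = 0" and x: "x \<in> {V1 K, V2 K, V5 K, V6 K}"
    then have "f (V1 K) *\<^sub>R V1 K + f (V2 K) *\<^sub>R V2 K + f (V5 K) *\<^sub>R V5 K + f (V6 K) *\<^sub>R V6 K = 0"
      using distinct by (simp add: add.assoc)
    then have "f (V6 K) = 0 \<and> f (V1 K) = 0 \<and> f (V2 K) = 0 \<and> f (V5 K) = 0"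
      using c unfolding zero_prod_def by (auto simp: K V1_def V2_def V5_def V6_def)
    with x show "f x = 0" by blast
  qed simp
qed

lemma rank_Delta_E_S2_minus_S1:
  assumes "K \<in> S2 - S1"
  shows "rank_Delta_E K = 4"
proof -
  have "Delta_E K = span {V1 K, V2 K, V5 K, V6 K}"
    unfolding Delta_E_eq
  proof (rule span_eq[THEN iffD2], intro conjI)
    show "{V1 K, V2 K, V3 K, V4 K, V5 K, V6 K} \<subseteq> span {V1 K, V2 K, V5 K, V6 K}"
      using V3_V4_in_span[OF assms] by (auto intro: span_base)
    show "{V1 K, V2 K, V5 K, V6 K} \<subseteq> span {V1 K, V2 K, V3 K, V4 K, V5 K, V6 K}"
      by (auto intro: span_base)
  qed
  then show ?thesis
    using independent_V1_V2_V5_V6[of K] assms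
    by (simp add: rank_Delta_E_def dim_span dim_eq_card_independent)
qed

section \<open>Invariance under the group\<close>

text \<open>The squared modulus of the complex number whose vanishing describes \<open>S2\<close>.  The rotation
  mixes its real and imaginary parts, so that only the modulus satisfies a scalar equation.\<close>

definition S2_defect :: "killing \<Rightarrow> real" where
  "S2_defect = (\<lambda>(A, B, C, \<alpha>, \<beta>, \<gamma>).
     (\<alpha>\<^sup>2 - \<beta>\<^sup>2 - \<gamma> * (A - B))\<^sup>2 + (2 * (\<alpha> * \<beta> + \<gamma> * C))\<^sup>2)"

definition gamma_coord :: "killing \<Rightarrow> real" where
  "gamma_coord = (\<lambda>(A, B, C, \<alpha>, \<beta>, \<gamma>). \<gamma>)"

lemma mem_S2_minus_S1_iff:
  "K \<in> S2 - S1 \<longleftrightarrow> S2_defect K = 0 \<and> gamma_coord K \<noteq> 0"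
  by (cases K) (auto simp: S1_def S2_def S2_defect_def gamma_coord_def sum_power2_eq_zero_iff)

lemma scalar_linear_ode_solution:
  fixes u :: "real \<Rightarrow> real"
  assumes u: "\<And>t. (u has_real_derivative k * u t) (at t)"
  shows "u t = u 0 * exp (k * t)"
proof -
  have "((\<lambda>s. u s * exp (- (k * s))) has_real_derivative 0) (at s)" for s
    by (auto intro!: derivative_eq_intros u)
  then have "u t * exp (- (k * t)) = u 0 * exp (- (k * 0))"
    by (intro DERIV_isconst_all) blast
  then show ?thesis
    by (simp add: exp_minus field_simps)
qed

lemma has_vector_derivative_killingD:
  assumes "(f has_vector_derivative (A', B', C', a', b', c')) (at t)"
  shows "((\<lambda>s. fst (f s)) has_real_derivative A') (at t)"
    "((\<lambda>s. fst (snd (f s))) has_real_derivative B') (at t)"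
    "((\<lambda>s. fst (snd (snd (f s)))) has_real_derivative C') (at t)"
    "((\<lambda>s. fst (snd (snd (snd (f s))))) has_real_derivative a') (at t)"
    "((\<lambda>s. fst (snd (snd (snd (snd (f s)))))) has_real_derivative b') (at t)"
    "((\<lambda>s. snd (snd (snd (snd (snd (f s)))))) has_real_derivative c') (at t)"
proof -
  note fst' = bounded_linear.has_vector_derivative[OF bounded_linear_fst]
  note snd' = bounded_linear.has_vector_derivative[OF bounded_linear_snd]
  note s1 = snd'[OF assms] note s2 = snd'[OF s1] note s3 = snd'[OF s2] note s4 = snd'[OF s3]
  show "((\<lambda>s. fst (f s)) has_real_derivative A') (at t)"
    "((\<lambda>s. fst (snd (f s))) has_real_derivative B') (at t)"
    "((\<lambda>s. fst (snd (snd (f s)))) has_real_derivative C') (at t)"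
    "((\<lambda>s. fst (snd (snd (snd (f s))))) has_real_derivative a') (at t)"
    "((\<lambda>s. fst (snd (snd (snd (snd (f s)))))) has_real_derivative b') (at t)"
    "((\<lambda>s. snd (snd (snd (snd (snd (f s)))))) has_real_derivative c') (at t)"
    using fst'[OF assms] fst'[OF s1] fst'[OF s2] fst'[OF s3] fst'[OF s4] snd'[OF s4]
    by (simp_all add: has_real_derivative_iff_has_vector_derivative)
qed

lemma S2_defect_has_derivative:
  assumes f: "(f has_vector_derivative (A', B', C', a', b', c')) (at t)"
    and ft: "f t = (A, B, C, a, b, c)"
  shows "((\<lambda>s. S2_defect (f s)) has_real_derivative
      2 * (a\<^sup>2 - b\<^sup>2 - c * (A - B)) * (2 * a * a' - 2 * b * b' - c' * (A - B) - c * (A' - B'))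
      + 8 * (a * b + c * C) * (a' * b + a * b' + c' * C + c * C')) (at t)"
  unfolding S2_defect_def case_prod_beta
  by (rule derivative_eq_intros has_vector_derivative_killingD[OF f] refl)+
     (simp add: ft algebra_simps)

lemma gamma_coord_has_derivative:
  assumes f: "(f has_vector_derivative (A', B', C', a', b', c')) (at t)"
  shows "((\<lambda>s. gamma_coord (f s)) has_real_derivative c') (at t)"
  using has_vector_derivative_killingD(6)[OF f] by (simp add: gamma_coord_def case_prod_beta)

text \<open>The dilatation and the scaling act on the defect with weight \<open>4\<close>.  Under the rotation, with
  \<open>F\<close> the real part and \<open>H\<close> half the imaginary part, \<open>F' = 4 H\<close> and \<open>H' = - F\<close>, so that
  \<open>F\<^sup>2 + 4 H\<^sup>2\<close> is constant.\<close>

lemma generator_rescales: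
  assumes V: "V \<in> generators_E"
  shows "\<exists>k l. \<forall>f t. (f has_vector_derivative V (f t)) (at t) \<longrightarrow>
    ((\<lambda>s. S2_defect (f s)) has_real_derivative k * S2_defect (f t)) (at t) \<and>
    ((\<lambda>s. gamma_coord (f s)) has_real_derivative l * gamma_coord (f t)) (at t)"
proof -
  \<comment> \<open>The velocities of \<open>F\<close> and \<open>H\<close>: a dilatation at rate \<open>k\<close> and a rotation at rate \<open>2 m\<close> of
    \<open>F + 2 \<i> H\<close>, which together change its squared modulus at rate \<open>2 k\<close>.\<close>
  have rescales: ?thesis
    if rates: "\<And>A B C a b c. \<exists>A' B' C' a' b'. V (A, B, C, a, b, c) = (A', B', C', a', b', l * c) \<and>
        2 * a * a' - 2 * b * b' - l * c * (A - B) - c * (A' - B')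
          = k * (a\<^sup>2 - b\<^sup>2 - c * (A - B)) + 4 * m * (a * b + c * C) \<and>
        a' * b + a * b' + l * c * C + c * C'
          = k * (a * b + c * C) - m * (a\<^sup>2 - b\<^sup>2 - c * (A - B))" for l k m
  proof (intro exI allI impI)
    fix f :: "real \<Rightarrow> killing" and t
    assume f: "(f has_vector_derivative V (f t)) (at t)"
    obtain A B C a b c where ft: "f t = (A, B, C, a, b, c)" by (cases "f t")
    define F where "F = a\<^sup>2 - b\<^sup>2 - c * (A - B)"
    define H where "H = a * b + c * C"
    obtain A' B' C' a' b' where V': "V (f t) = (A', B', C', a', b', l * c)" and
      F': "2 * a * a' - 2 * b * b' - l * c * (A - B) - c * (A' - B') = k * F + 4 * m * H" and
      H': "a' * b + a * b' + l * c * C + c * C' = k * H - m * F"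
      using rates[of A B C a b c] ft unfolding F_def H_def by metis
    have "2 * F * (k * F + 4 * m * H) + 8 * H * (k * H - m * F) = 2 * k * (F\<^sup>2 + (2 * H)\<^sup>2)"
      by (simp add: algebra_simps power2_eq_square)
    also have "F\<^sup>2 + (2 * H)\<^sup>2 = S2_defect (f t)"
      by (simp add: S2_defect_def ft F_def H_def)
    finally have "((\<lambda>s. S2_defect (f s)) has_real_derivative 2 * k * S2_defect (f t)) (at t)"
      using S2_defect_has_derivative[OF f[unfolded V'] ft, folded F_def H_def, unfolded F' H']
      by simp
    moreover have "((\<lambda>s. gamma_coord (f s)) has_real_derivative l * gamma_coord (f t)) (at t)"
      using gamma_coord_has_derivative[OF f[unfolded V']] by (simp add: ft gamma_coord_def)
    ultimately show "((\<lambda>s. S2_defect (f s)) has_real_derivative 2 * k * S2_defect (f t)) (at t) \<and>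
        ((\<lambda>s. gamma_coord (f s)) has_real_derivative l * gamma_coord (f t)) (at t)" ..
  qed
  consider "V = V1" | "V = V2" | "V = V3" | "V = V4" | "V = V5" | "V = V6"
    using V unfolding generators_E_def by blast
  then show ?thesis
  proof cases
    case 1
    show ?thesis
      by (rule rescales[of 0 0 0]) (simp add: 1 V1_def algebra_simps power2_eq_square)
  next
    case 2
    show ?thesis
      by (rule rescales[of 0 0 0]) (simp add: 2 V2_def algebra_simps power2_eq_square)
  next
    case 3
    show ?thesis
    proof (rule rescales[of 0 0 1], intro exI conjI)
      show "V (A, B, C, a, b, c) = (- 2 * C, 2 * C, A - B, b, - a, 0 * c)" for A B C a b c
        by (simp add: 3 V3_def)
    qed (simp_all add: algebra_simps power2_eq_square)
  next
    case 4
    show ?thesis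
      by (rule rescales[of 0 2 0]) (simp add: 4 V4_def algebra_simps power2_eq_square)
  next
    case 5
    show ?thesis
      by (rule rescales[of 0 0 0]) (simp add: 5 V5_def algebra_simps power2_eq_square)
  next
    case 6
    show ?thesis
      by (rule rescales[of 1 2 0]) (simp add: 6 V6_def algebra_simps power2_eq_square)
  qed
qed

lemma flow_preserves_S2_minus_S1:
  assumes g: "g \<in> flow_maps_E"
  shows "g K \<in> S2 - S1 \<longleftrightarrow> K \<in> S2 - S1"
proof -
  obtain V \<phi> t where V: "V \<in> generators_E" and flow: "is_flow V \<phi>" and g_eq: "g = \<phi> t"
    using g unfolding flow_maps_E_def by blast
  obtain k l where
    "((\<lambda>s. S2_defect (\<phi> s K)) has_real_derivative k * S2_defect (\<phi> s K)) (at s)"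
    "((\<lambda>s. gamma_coord (\<phi> s K)) has_real_derivative l * gamma_coord (\<phi> s K)) (at s)" for s
    using generator_rescales[OF V] flow unfolding is_flow_def by blast
  from this[THEN scalar_linear_ode_solution, of t]
  have "S2_defect (\<phi> t K) = S2_defect K * exp (k * t)"
    "gamma_coord (\<phi> t K) = gamma_coord K * exp (l * t)"
    using flow unfolding is_flow_def by metis+
  then show ?thesis
    by (simp only: g_eq mem_S2_minus_S1_iff) simp
qed

lemma uminus_preserves_S2_minus_S1: "- K \<in> S2 - S1 \<longleftrightarrow> K \<in> S2 - S1"
  by (cases K) (auto simp: S1_def S2_def algebra_simps)

lemma G_E_preserves_S2_minus_S1:
  assumes "g \<in> carrier G_E"
  shows "g K \<in> S2 - S1 \<longleftrightarrow> K \<in> S2 - S1"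
proof -
  let ?H = "carrier (BijGroup UNIV) \<inter> (flow_maps_E \<union> {uminus})"
  have generator: "h L \<in> S2 - S1 \<longleftrightarrow> L \<in> S2 - S1" if "h \<in> ?H" for h L
    using that by (elim IntE UnE singletonE)
      (simp_all only: flow_preserves_S2_minus_S1 uminus_preserves_S2_minus_S1)
  have "g \<in> generate (BijGroup UNIV) ?H"
    using assms by (simp add: G_E_def carrier_subgroup_generated)
  then show ?thesis
  proof (induction g arbitrary: K rule: generate.induct)
    case one
    then show ?case by (simp add: BijGroup_def)
  next
    case (incl h)
    then show ?case by (rule generator)
  next
    case (inv h)
    then have h: "h \<in> Bij UNIV" by (simp add: BijGroup_def)
    then have "h (inv_into UNIV h K) = K"
      by (simp add: Bij_def bij_is_surj surj_f_inv_f)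
    moreover have "(inv\<^bsub>BijGroup UNIV\<^esub> h) K = inv_into UNIV h K"
      by (simp add: inv_BijGroup[OF h])
    ultimately show ?case
      using generator[OF inv, of "inv_into UNIV h K"] by (simp only:)
  next
    case (eng h1 h2)
    have "h \<in> Bij UNIV" if "h \<in> generate (BijGroup UNIV) ?H" for h
      using group.generate_in_carrier[OF group_BijGroup Int_lower1 that]
      by (simp add: BijGroup_def)
    then have "h1 \<in> Bij UNIV" "h2 \<in> Bij UNIV"
      using eng.hyps by blast+
    then have "(h1 \<otimes>\<^bsub>BijGroup UNIV\<^esub> h2) K = h1 (h2 K)"
      by (simp add: BijGroup_def compose_def)
    then show ?case by (simp only: eng.IH)
  qed
qed

section \<open>Transitivity\<close>

text \<open>Flow maps enter the group only if they are bijections; for a one-parameter group this is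
  automatic, time \<open>- t\<close> inverting time \<open>t\<close>.\<close>

lemma flow_reaches:
  assumes V: "V \<in> generators_E" and flow: "is_flow V \<phi>"
    and inverse: "\<And>t K. \<phi> (- t) (\<phi> t K) = K"
  shows "\<phi> t K \<in> orbit G_E (\<lambda>g. g) K"
proof -
  have "\<phi> t (\<phi> (- t) K) = K" for t K
    using inverse[of "- t" K] by simp
  then have "bij (\<phi> t)"
    using inverse by (intro o_bij[of "\<phi> (- t)"]) (auto simp: fun_eq_iff)
  then have "\<phi> t \<in> carrier (BijGroup UNIV)"
    by (simp add: BijGroup_def Bij_def)
  moreover have "\<phi> t \<in> flow_maps_E"
    using V flow unfolding flow_maps_E_def by blast
  ultimately have "\<phi> t \<in> carrier G_E"
    by (auto simp: G_E_def carrier_subgroup_generated intro: generate.incl)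
  then show ?thesis
    by (auto simp: orbit_def)
qed

lemma uminus_reaches: "- K \<in> orbit G_E (\<lambda>g. g) K"
proof -
  have "uminus \<in> carrier (BijGroup (UNIV :: killing set))"
    by (simp add: BijGroup_def Bij_def bij_uminus)
  then have "uminus \<in> carrier G_E"
    by (auto simp: G_E_def carrier_subgroup_generated intro: generate.incl)
  then show ?thesis
    by (auto simp: orbit_def)
qed

lemma V1_reaches:
  "(A, B - 2 * b * t + c * t\<^sup>2, C + a * t, a, b - c * t, c) \<in> orbit G_E (\<lambda>g. g) (A, B, C, a, b, c)"
proof -
  let ?\<phi> = "\<lambda>t (A, B, C, a, b, c). (A, B - 2 * b * t + c * t\<^sup>2, C + a * t, a, b - c * t, c)"
  have "is_flow V1 ?\<phi>"
    unfolding is_flow_def V1_def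
    by (auto intro!: has_vector_derivative_Pair derivative_eq_intros
        simp: zero_prod_def has_real_derivative_iff_has_vector_derivative [symmetric] algebra_simps)
  then show ?thesis
    using flow_reaches[of V1 ?\<phi> t "(A, B, C, a, b, c)"]
    by (auto simp: generators_E_def algebra_simps power2_eq_square)
qed

lemma V2_reaches:
  "(A - 2 * a * t + c * t\<^sup>2, B, C + b * t, a - c * t, b, c) \<in> orbit G_E (\<lambda>g. g) (A, B, C, a, b, c)"
proof -
  let ?\<phi> = "\<lambda>t (A, B, C, a, b, c). (A - 2 * a * t + c * t\<^sup>2, B, C + b * t, a - c * t, b, c)"
  have "is_flow V2 ?\<phi>"
    unfolding is_flow_def V2_def
    by (auto intro!: has_vector_derivative_Pair derivative_eq_intros
        simp: zero_prod_def has_real_derivative_iff_has_vector_derivative [symmetric] algebra_simps)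
  then show ?thesis
    using flow_reaches[of V2 ?\<phi> t "(A, B, C, a, b, c)"]
    by (auto simp: generators_E_def algebra_simps power2_eq_square)
qed

lemma V5_reaches:
  "(A + t, B + t, C, a, b, c) \<in> orbit G_E (\<lambda>g. g) (A, B, C, a, b, c)"
proof -
  let ?\<phi> = "\<lambda>t (A, B, C, a, b, c). (A + t, B + t, C, a, b, c)"
  have "is_flow V5 ?\<phi>"
    unfolding is_flow_def V5_def
    by (auto intro!: has_vector_derivative_Pair derivative_eq_intros
        simp: zero_prod_def has_real_derivative_iff_has_vector_derivative [symmetric])
  then show ?thesis
    using flow_reaches[of V5 ?\<phi> t "(A, B, C, a, b, c)"]
    by (auto simp: generators_E_def)
qed

lemma V6_reaches: "exp t *\<^sub>R K \<in> orbit G_E (\<lambda>g. g) K"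
proof -
  have "is_flow V6 (\<lambda>t K. exp t *\<^sub>R K)"
    unfolding is_flow_def V6_def
    by (auto intro!: derivative_eq_intros
        simp: has_real_derivative_iff_has_vector_derivative [symmetric])
  then show ?thesis
    by (intro flow_reaches[of V6]) (auto simp: generators_E_def simp flip: exp_add)
qed

lemma scaling_reaches:
  assumes "c \<noteq> 0"
  shows "c *\<^sub>R K \<in> orbit G_E (\<lambda>g. g) K"
proof (cases "c > 0")
  case True
  then show ?thesis using V6_reaches[of "ln c" K] by simp
next
  case False
  then have "exp (ln (- c)) = - c" using assms by simp
  then have "(- c) *\<^sub>R K \<in> orbit G_E (\<lambda>g. g) K" using V6_reaches[of "ln (- c)" K] by simp
  from group_action.orbit_trans[OF group_action_G_E _ _ _ this uminus_reaches]
  show ?thesis by simp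
qed

text \<open>The tensor \<open>(0, 0, 0, 0, 0, 1)\<close> is that of the polar web with centre at the origin.\<close>

lemma S2_minus_S1_reached:
  assumes "K \<in> S2 - S1"
  shows "K \<in> orbit G_E (\<lambda>g. g) (0, 0, 0, 0, 0, 1)"
proof -
  obtain A B C a b c where K: "K = (A, B, C, a, b, c)" by (cases K)
  have c: "c \<noteq> 0" and ab: "a\<^sup>2 - b\<^sup>2 = c * (A - B)" "a * b = - c * C"
    using assms by (auto simp: K S1_def S2_def)
  note trans = group_action.orbit_trans[OF group_action_G_E UNIV_I UNIV_I UNIV_I]
  have 1: "(0, 0, 0, 0, 0, c) \<in> orbit G_E (\<lambda>g. g) (0, 0, 0, 0, 0, 1)"
    using scaling_reaches[OF c, of "(0, 0, 0, 0, 0, 1)"] by simp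
  have 2: "(0, b\<^sup>2 / c, 0, 0, b, c) \<in> orbit G_E (\<lambda>g. g) (0, 0, 0, 0, 0, c)"
    using V1_reaches[of 0 0 0 "- b / c" c 0 0] c by (simp add: power2_eq_square)
  have 3: "(a\<^sup>2 / c, b\<^sup>2 / c, - (a * b) / c, a, b, c) \<in> orbit G_E (\<lambda>g. g) (0, b\<^sup>2 / c, 0, 0, b, c)"
    using V2_reaches[of 0 0 "- a / c" c "b\<^sup>2 / c" 0 b] c
    by (simp add: power2_eq_square mult.commute)
  have "B = b\<^sup>2 / c + (A - a\<^sup>2 / c)" "C = - (a * b) / c"
    using c ab by (auto simp: field_simps)
  then have 4: "K \<in> orbit G_E (\<lambda>g. g) (a\<^sup>2 / c, b\<^sup>2 / c, - (a * b) / c, a, b, c)"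
    using V5_reaches[of "a\<^sup>2 / c" "A - a\<^sup>2 / c" "b\<^sup>2 / c" "- (a * b) / c" a b c] by (simp add: K)
  show ?thesis
    by (rule trans[OF trans[OF trans[OF 1 2] 3] 4])
qed

lemma orbit_eq_S2_minus_S1: "orbit G_E (\<lambda>g. g) (0, 0, 0, 0, 0, 1) = S2 - S1"
proof
  have "(0, 0, 0, 0, 0, 1) \<in> S2 - S1"
    by (simp add: S1_def S2_def)
  then show "orbit G_E (\<lambda>g. g) (0, 0, 0, 0, 0, 1) \<subseteq> S2 - S1"
    unfolding orbit_def using G_E_preserves_S2_minus_S1 by blast
  show "S2 - S1 \<subseteq> orbit G_E (\<lambda>g. g) (0, 0, 0, 0, 0, 1)"
    using S2_minus_S1_reached by blast
qed

theorem proposition8: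
  shows "(\<forall>K \<in> S2 - S1. rank_Delta_E K = 4) \<and> S2 - S1 \<in> orbits G_E UNIV (\<lambda>g. g)"
  using rank_Delta_E_S2_minus_S1 orbit_eq_S2_minus_S1 unfolding orbits_def by blast

end
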